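(* Let $T$ be a finite rooted tree with root $v_0$ and at least one vertex other than the root, and let $n$ be the maximum level of a vertex of $T$. Let $u_n,u_{n-1},\ldots,u_1$ be any sequence produced by the Unburning Algorithm on $T$ (with ties broken arbitrarily). Then the number of vertices of $T$ saved by vaccinating $u_i$ at time step $i$ for $i=1,\ldots,n$, namely $\bigl|\bigcup_{i=1}^{n} V(T_{u_i})\bigr| = \sum_{i=1}^n \tilde{\mathrm{wt}}(u_i)$, is at least half of the maximum number of vertices of $T$ that can be saved by any vaccination strategy (one vaccination per time step) in the virus-spread model on $T$.
   Context: Virus-spread model on a rooted tree $T$ with root $v_0$: each vertex is susceptible, infected, or vaccinated, and these latter two states are permanent. At time step $0$ the root $v_0$ is infected and all other vertices are susceptible. At each time step $t=1,2,\ldots$, one susceptible vertex may be vaccinated, and then every susceptible vertex adjacent to an infected vertex becomes infected. The process continues until no infected vertex has a susceptible neighbor. A vertex is saved if it is never infected; an optimal strategy is one maximizing the number of saved vertices. Notation: the level of a vertex $v$ is $l(v)=d(v_0,v)$, the number of edges on the path from $v_0$ to $v$; $T_v$ denotes the subtree of $T$ rooted at $v$ (i.e. $v$ and all its descendants). Unburning Algorithm: working backwards from level $n$ (the maximum level) down to level $1$, for $i=n,n-1,\ldots,1$ choose a vertex $u_i$ with $l(u_i)=i$ as follows. For a vertex $v$ with $l(v)=i$, let $U_v=\bigcup V(T_{u})$, the union over those already chosen vertices $u\in\{u_n,\ldots,u_{i+1}\}$ that lie in $T_v$ (empty if there are none), and set $\tilde{\mathrm{wt}}(v)=|V(T_v)|-|U_v|$.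 Then $u_i$ is chosen among the vertices $v$ at level $i$ to maximize $\tilde{\mathrm{wt}}(v)$. *)

theory Defs
  imports Complex_Main "Graph_Theory.Digraph_Component" "Graph_Theory.Vertex_Walk"
begin

text \<open>
  Undirected graphs are the symmetric digraphs of locale \<open>graph\<close>, so an edge is a pair of
  opposite arcs.  The library predicates \<open>cycle\<close>, \<open>forest\<close> and \<open>tree\<close> are directed notions
  (the walk \<open>a, b, a\<close> along a single edge is a \<open>cycle\<close>), hence the length bound below.
\<close>

definition undirected_cycle :: "('a, 'b) pre_digraph \<Rightarrow> 'a list \<Rightarrow> bool" where
  "undirected_cycle G p \<longleftrightarrow>
     vwalk p G \<and> hd p = last p \<and> distinct (tl p) \<and> 3 \<le> vwalk_length p"

locale rooted_tree = graph T for T :: "('a, 'b) pre_digraph" +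
  fixes r :: 'a
  assumes connected: "Digraph_Component.connected T"
    and acyclic: "\<not> (\<exists>p. undirected_cycle T p)"
    and root_in_verts: "r \<in> verts T"

definition path_between :: "('a, 'b) pre_digraph \<Rightarrow> 'a \<Rightarrow> 'a list \<Rightarrow> 'a \<Rightarrow> bool" where
  "path_between G u p v \<longleftrightarrow> vpath p G \<and> hd p = u \<and> last p = v"

definition graph_dist :: "('a, 'b) pre_digraph \<Rightarrow> 'a \<Rightarrow> 'a \<Rightarrow> nat" where
  "graph_dist G u v = (LEAST k. \<exists>p. path_between G u p v \<and> vwalk_length p = k)"

abbreviation level :: "('a, 'b) pre_digraph \<Rightarrow> 'a \<Rightarrow> 'a \<Rightarrow> nat" where
  "level T r v \<equiv> graph_dist T r v"

definition max_level :: "('a, 'b) pre_digraph \<Rightarrow> 'a \<Rightarrow> nat" where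
  "max_level T r = Max (level T r ` verts T)"

text \<open>The vertex set of \<open>T\<^sub>v\<close>: the vertices whose path from the root passes through \<open>v\<close>.\<close>

definition subtree_verts :: "('a, 'b) pre_digraph \<Rightarrow> 'a \<Rightarrow> 'a \<Rightarrow> 'a set" where
  "subtree_verts T r v = {w \<in> verts T. \<exists>p. path_between T r p w \<and> v \<in> set p}"


subsection \<open>The virus-spread model\<close>

datatype status = Susceptible | Infected | Vaccinated

text \<open>A strategy gives, for each time step \<open>t \<ge> 1\<close>, the vertex vaccinated at that step, if any.\<close>

type_synonym 'a strategy = "nat \<Rightarrow> 'a option"

definition vaccinate :: "'a option \<Rightarrow> ('a \<Rightarrow> status) \<Rightarrow> 'a \<Rightarrow> status" where
  "vaccinate x s = (case x of None \<Rightarrow> s | Some v \<Rightarrow> s(v := Vaccinated))"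

definition spread :: "('a, 'b) pre_digraph \<Rightarrow> ('a \<Rightarrow> status) \<Rightarrow> 'a \<Rightarrow> status" where
  "spread G s v =
     (if s v = Susceptible \<and> (\<exists>w. w \<rightarrow>\<^bsub>G\<^esub> v \<and> s w = Infected) then Infected else s v)"

primrec state :: "('a, 'b) pre_digraph \<Rightarrow> 'a \<Rightarrow> 'a strategy \<Rightarrow> nat \<Rightarrow> 'a \<Rightarrow> status" where
  "state G r \<sigma> 0 = (\<lambda>v. if v = r then Infected else Susceptible)"
| "state G r \<sigma> (Suc t) = spread G (vaccinate (\<sigma> (Suc t)) (state G r \<sigma> t))"

definition valid_strategy :: "('a, 'b) pre_digraph \<Rightarrow> 'a \<Rightarrow> 'a strategy \<Rightarrow> bool" where
  "valid_strategy G r \<sigma> \<longleftrightarrow>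
     (\<forall>t v. \<sigma> (Suc t) = Some v \<longrightarrow> v \<in> verts G \<and> state G r \<sigma> t v = Susceptible)"

text \<open>
  The process is run for all times: once no infected vertex has a susceptible neighbour,
  further steps infect nothing, so the saved vertices are those at termination.
\<close>

definition saved :: "('a, 'b) pre_digraph \<Rightarrow> 'a \<Rightarrow> 'a strategy \<Rightarrow> 'a set" where
  "saved G r \<sigma> = {v \<in> verts G. \<forall>t. state G r \<sigma> t v \<noteq> Infected}"

definition max_saved :: "('a, 'b) pre_digraph \<Rightarrow> 'a \<Rightarrow> nat" where
  "max_saved G r = Max {card (saved G r \<sigma>) | \<sigma>. valid_strategy G r \<sigma>}"


subsection \<open>The Unburning Algorithm\<close>

text \<open>
  A run is a function \<open>u\<close> of which only the values \<open>u 1, \<dots>, u n\<close> matter, where \<open>n\<close> is the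
  maximum level.  For \<open>v\<close> at level \<open>i\<close>, \<open>covered T r u v\<close> is \<open>U\<^sub>v\<close>; it depends only on
  \<open>u n, \<dots>, u (i + 1)\<close>.
\<close>

definition covered :: "('a, 'b) pre_digraph \<Rightarrow> 'a \<Rightarrow> (nat \<Rightarrow> 'a) \<Rightarrow> 'a \<Rightarrow> 'a set" where
  "covered T r u v =
     (\<Union>j \<in> {j. level T r v < j \<and> j \<le> max_level T r \<and> u j \<in> subtree_verts T r v}.
        subtree_verts T r (u j))"

definition unburning_weight :: "('a, 'b) pre_digraph \<Rightarrow> 'a \<Rightarrow> (nat \<Rightarrow> 'a) \<Rightarrow> 'a \<Rightarrow> int" where
  "unburning_weight T r u v =
     int (card (subtree_verts T r v)) - int (card (covered T r u v))"

definition unburning_sequence :: "('a, 'b) pre_digraph \<Rightarrow> 'a \<Rightarrow> (nat \<Rightarrow> 'a) \<Rightarrow> bool" where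
  "unburning_sequence T r u \<longleftrightarrow>
     (\<forall>i \<in> {1..max_level T r}.
        u i \<in> verts T \<and> level T r (u i) = i \<and>
        (\<forall>v \<in> verts T. level T r v = i \<longrightarrow>
           unburning_weight T r u v \<le> unburning_weight T r u (u i)))"

definition sequence_strategy :: "nat \<Rightarrow> (nat \<Rightarrow> 'a) \<Rightarrow> 'a strategy" where
  "sequence_strategy n u = (\<lambda>t. if t \<in> {1..n} then Some (u t) else None)"

end

theory Submission
  imports Defs
begin

text \<open>
  On a tree, a vertex vaccinated at time \<open>t\<close> at level at least \<open>t\<close> may be replaced by its
  ancestor at level \<open>t\<close>, so any strategy saves at most \<open>\<Union>i. T\<^sub>w\<^sub>i\<close> for some choice of one vertex
  \<open>w\<^sub>i\<close> per level.  Write \<open>A\<close> for the set saved by the algorithm.  Since \<open>U\<^sub>w \<subseteq> A \<inter> T\<^sub>w\<close>, the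
  vertices of \<open>T\<^sub>w\<^sub>i\<close> outside \<open>A\<close> number at most \<open>wt(w\<^sub>i) \<le> wt(u\<^sub>i)\<close>.  Summing over the levels,
  the vertices saved by the other strategy but not by the algorithm number at most
  \<open>\<Sum>i. wt(u\<^sub>i) = card A\<close>.
\<close>

section \<open>Paths and subtrees in a rooted tree\<close>

lemma (in wf_digraph) vwalk_nth_adj:
  assumes "vwalk p G" "Suc i < length p"
  shows "p ! i \<rightarrow>\<^bsub>G\<^esub> p ! Suc i"
proof -
  have "p = take i p @ p ! i # p ! Suc i # drop (Suc (Suc i)) p"
    using assms(2) by (simp add: Cons_nth_drop_Suc)
  then have "vwalk (p ! i # p ! Suc i # drop (Suc (Suc i)) p) G"
    using assms(1) vwalkI_append_r by (metis list.distinct(1))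
  then show ?thesis
    by simp
qed

lemma path_between_prefix:
  "path_between G a (p @ v # q) b \<Longrightarrow> path_between G a (p @ [v]) v"
  unfolding path_between_def vpath_def
  using vwalkI_append_l[of "p @ [v]" q G] by (cases p) auto

lemma (in wf_digraph) path_between_snoc:
  assumes "path_between G a p w" "w \<rightarrow>\<^bsub>G\<^esub> v" "v \<notin> set p"
  shows "path_between G a (p @ [v]) v"
proof -
  have p: "p \<noteq> []" "vwalk p G" "hd p = a" "last p = w" "distinct p"
    using assms(1) by (auto simp: path_between_def vpath_def)
  moreover have "vwalk [w, v] G"
    using assms(2) adj_in_verts by auto
  ultimately have "vwalk (p @ [v]) G"
    using vwalk_joinI_vwalk'[of p G "[w, v]"] by (simp add: vwalk_join_def)
  then show ?thesis
    using p assms(3) by (auto simp: path_between_def vpath_def)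
qed

context rooted_tree
begin

lemma path_between_unique:
  "path_between T a p b \<Longrightarrow> path_between T a q b \<Longrightarrow> p = q"
proof (induction p arbitrary: a q)
  case Nil
  then show ?case
    by (auto simp: path_between_def vpath_def vwalk_def)
next
  case (Cons x p')
  have p: "vwalk (a # p') T" "distinct (a # p')" "last (a # p') = b" and [simp]: "x = a"
    using Cons.prems(1) by (auto simp: path_between_def vpath_def)
  obtain q' where q_eq: "q = a # q'"
    using Cons.prems(2) by (cases q) (auto simp: path_between_def vpath_def vwalk_def)
  have q: "vwalk (a # q') T" "distinct (a # q')" "last (a # q') = b"
    using Cons.prems(2) by (auto simp: path_between_def vpath_def q_eq)
  show ?case
  proof (cases "p' = [] \<or> q' = []")
    case True
    then show ?thesis
      using p q q_eq last_in_set[of p'] last_in_set[of q'] by (auto split: if_splits)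
  next
    case False
    then have ne: "p' \<noteq> []" "q' \<noteq> []"
      by auto
    have w: "vwalk p' T" "vwalk q' T"
      using p(1) q(1) ne vwalk_consE by metis+
    show ?thesis
    proof (cases "hd p' = hd q'")
      case True
      have "path_between T (hd p') p' b" "path_between T (hd p') q' b"
        using w p q ne True by (auto simp: path_between_def vpath_def)
      then show ?thesis
        using Cons.IH q_eq by simp
    next
      case neq: False
      \<comment> \<open>The paths diverge right after \<open>a\<close>; closing them up at the first vertex \<open>z\<close> where they
          meet again gives a cycle.\<close>
      have "\<exists>z \<in> set p'. z \<in> set q'"
        using p(3) q(3) ne last_in_set by (metis last.simps)
      then obtain p1 z p2 where p': "p' = p1 @ z # p2" "z \<in> set q'" "\<forall>y \<in> set p1. y \<notin> set q'"
        by (rule split_list_first_propE)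
      obtain q1 q2 where q': "q' = q1 @ z # q2"
        using p'(2) by (meson split_list)
      have "vwalk (a # p1 @ [z]) T"
        using vwalkI_append_l[of "a # p1 @ [z]" p2] p(1) p'(1) by simp
      moreover have "vwalk (a # q1 @ [z]) T"
        using vwalkI_append_l[of "a # q1 @ [z]" q2] q(1) q' by simp
      then have "vwalk (z # rev q1 @ [a]) T"
        using vwalk_rev_ex[OF sym_arcs, of "a # q1 @ [z]"] by simp
      ultimately have "vwalk (a # p1 @ z # rev q1 @ [a]) T"
        using vwalk_joinI_vwalk'[of "a # p1 @ [z]" T "z # rev q1 @ [a]"]
        by (simp add: vwalk_join_def)
      moreover have "distinct (p1 @ z # rev q1 @ [a])"
        using p(2) q(2) p' q' by auto
      moreover have "p1 \<noteq> [] \<or> q1 \<noteq> []"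
        using neq p' q' by auto
      then have "length p1 + length q1 \<ge> 1"
        by (cases p1; cases q1) auto
      ultimately have "undirected_cycle T (a # p1 @ z # rev q1 @ [a])"
        by (simp add: undirected_cycle_def)
      then show ?thesis
        using acyclic by blast
    qed
  qed
qed

lemma path_from_root_exists:
  assumes "v \<in> verts T"
  obtains p where "path_between T r p v"
proof -
  have "r \<rightarrow>\<^sup>*\<^bsub>T\<^esub> v"
    using symmetric_connected_imp_strongly_connected[OF sym_arcs connected] assms root_in_verts
    by (auto simp: strongly_connected_def)
  then show ?thesis
    using that by (auto simp: reachable_vpath_conv path_between_def)
qed

lemma level_eq_length:
  assumes "path_between T r p v"
  shows "level T r v = length p - 1"
  unfolding graph_dist_def
proof (rule Least_equality)
  show "\<exists>q. path_between T r q v \<and> vwalk_length q = length p - 1"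
    using assms by auto
qed (use assms path_between_unique in fastforce)

lemma path_between_take:
  assumes "path_between T r p v" "i < length p"
  shows "path_between T r (take (Suc i) p) (p ! i)"
  using path_between_prefix[of T r "take i p" "p ! i" "drop (Suc i) p" v] assms
  by (simp add: id_take_nth_drop[symmetric] take_Suc_conv_app_nth)

lemma level_path_nth:
  assumes "path_between T r p v" "i < length p"
  shows "level T r (p ! i) = i"
  using level_eq_length[OF path_between_take[OF assms]] assms(2) by simp

lemma path_from_root_props:
  assumes "path_between T r p v"
  shows "p \<noteq> []" "set p \<subseteq> verts T" "p ! 0 = r" "v \<in> set p" "v \<in> verts T"
    "level T r v < length p" "p ! level T r v = v" "vwalk p T"
proof -
  have p: "p \<noteq> []" "set p \<subseteq> verts T" "hd p = r" "last p = v" "vwalk p T"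
    using assms by (auto simp: path_between_def vpath_def vwalk_def)
  then show "p \<noteq> []" "set p \<subseteq> verts T" "v \<in> set p" "v \<in> verts T" "vwalk p T"
    by auto
  show "p ! 0 = r" "level T r v < length p" "p ! level T r v = v"
    using p level_eq_length[OF assms] by (auto simp: hd_conv_nth last_conv_nth)
qed

lemma subtree_verts_iff:
  assumes "path_between T r p w"
  shows "w \<in> subtree_verts T r v \<longleftrightarrow> v \<in> set p"
  using assms path_between_unique path_from_root_props(5)[OF assms]
  by (auto simp: subtree_verts_def)

lemma subtree_verts_subset_verts: "subtree_verts T r v \<subseteq> verts T"
  by (auto simp: subtree_verts_def)

lemma finite_subtree_verts [simp]: "finite (subtree_verts T r v)"
  using finite_subset[OF subtree_verts_subset_verts] by simp

lemma path_nth_in_subtree_verts: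
  assumes "path_between T r p w" "i \<le> j" "j < length p"
  shows "p ! j \<in> subtree_verts T r (p ! i)"
proof -
  have "p ! i \<in> set (take (Suc j) p)"
    using assms by (auto simp: in_set_conv_nth intro!: exI[of _ i])
  then show ?thesis
    using subtree_verts_iff[OF path_between_take[OF assms(1,3)]] by simp
qed

lemma in_path_nth_level:
  assumes "path_between T r p w" "v \<in> set p"
  shows "level T r v < length p" "p ! level T r v = v"
  using assms level_path_nth[OF assms(1)] by (auto simp: in_set_conv_nth)

lemma subtree_verts_mono:
  assumes "v \<in> subtree_verts T r u"
  shows "subtree_verts T r v \<subseteq> subtree_verts T r u"
proof
  fix w assume "w \<in> subtree_verts T r v"
  then obtain p where p: "path_between T r p w" "v \<in> set p"
    by (auto simp: subtree_verts_def)
  note v = in_path_nth_level[OF p]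
  have "path_between T r (take (Suc (level T r v)) p) v"
    using path_between_take[OF p(1) v(1)] v(2) by simp
  then have "u \<in> set p"
    using subtree_verts_iff assms in_set_takeD by metis
  then show "w \<in> subtree_verts T r u"
    using subtree_verts_iff[OF p(1)] by simp
qed

lemma subtree_verts_comparable:
  assumes "w \<in> subtree_verts T r u" "w \<in> subtree_verts T r v" "level T r u \<le> level T r v"
  shows "v \<in> subtree_verts T r u"
proof -
  obtain p where p: "path_between T r p w" "u \<in> set p"
    using assms(1) by (auto simp: subtree_verts_def)
  then have "v \<in> set p"
    using assms(2) subtree_verts_iff by blast
  then show ?thesis
    using path_nth_in_subtree_verts[OF p(1) assms(3)] in_path_nth_level[OF p(1)] p(2) by simp
qed

lemma level_subtree_verts_ge:
  assumes "v \<in> subtree_verts T r u"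
  shows "level T r u \<le> level T r v"
proof -
  obtain p where p: "path_between T r p v" "u \<in> set p"
    using assms by (auto simp: subtree_verts_def)
  then show ?thesis
    using in_path_nth_level(1)[OF p] level_eq_length[OF p(1)] by simp
qed

lemma adj_cases:
  assumes "w \<rightarrow>\<^bsub>T\<^esub> v" "path_between T r p w"
  shows "v \<in> set p \<or> path_between T r (p @ [v]) v"
  using path_between_snoc[OF assms(2,1)] by blast

lemma level_adj_le:
  assumes "w \<rightarrow>\<^bsub>T\<^esub> v"
  shows "level T r v \<le> Suc (level T r w)"
proof -
  obtain p where p: "path_between T r p w"
    using path_from_root_exists assms adj_in_verts by blast
  from adj_cases[OF assms p] show ?thesis
  proof
    assume "v \<in> set p"
    then show ?thesis
      using in_path_nth_level(1)[OF p] level_eq_length[OF p] by fastforce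
  next
    assume "path_between T r (p @ [v]) v"
    then show ?thesis
      using level_eq_length p by fastforce
  qed
qed

lemma subtree_verts_entry:
  assumes "w \<rightarrow>\<^bsub>T\<^esub> v" "v \<in> subtree_verts T r u" "w \<notin> subtree_verts T r u"
  shows "v = u"
proof -
  obtain p where p: "path_between T r p w"
    using path_from_root_exists assms(1) adj_in_verts by blast
  from adj_cases[OF assms(1) p] show ?thesis
  proof
    assume "v \<in> set p"
    then have "w \<in> subtree_verts T r v"
      using subtree_verts_iff p by simp
    then show ?thesis
      using subtree_verts_mono assms by blast
  next
    assume "path_between T r (p @ [v]) v"
    then show ?thesis
      using subtree_verts_iff p assms by fastforce
  qed
qed

lemma level_le_max_level: "v \<in> verts T \<Longrightarrow> level T r v \<le> max_level T r"
  by (simp add: max_level_def)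

lemma level_eq_0_iff:
  assumes "v \<in> verts T"
  shows "level T r v = 0 \<longleftrightarrow> v = r"
proof -
  obtain p where p: "path_between T r p v"
    using path_from_root_exists assms by blast
  show ?thesis
    using path_from_root_props[OF p] level_path_nth[OF p, of 0] by auto
qed

lemma ancestor_at_level:
  assumes "v \<in> verts T" "i \<le> level T r v"
  obtains a where "a \<in> verts T" "level T r a = i" "v \<in> subtree_verts T r a"
proof -
  obtain p where p: "path_between T r p v"
    using path_from_root_exists assms(1) by blast
  note props = path_from_root_props[OF p]
  then have "i < length p"
    using assms(2) by simp
  moreover from this have "p ! i \<in> verts T"
    using props(2) nth_mem by blast
  ultimately show ?thesis
    using that[of "p ! i"] level_path_nth[OF p] path_nth_in_subtree_verts[OF p assms(2)]
      props(6,7) by auto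
qed


section \<open>The vertices saved by a strategy\<close>

lemma state_Vaccinated_imp:
  "state T r \<sigma> t v = Vaccinated \<Longrightarrow> \<exists>s \<in> {1..t}. \<sigma> s = Some v"
proof (induction t)
  case 0
  then show ?case
    by (auto split: if_splits)
next
  case (Suc t)
  then have "\<sigma> (Suc t) = Some v \<or> state T r \<sigma> t v = Vaccinated"
    by (auto simp: spread_def vaccinate_def split: if_splits option.splits)
  then show ?case
    using Suc.IH by (auto simp: atLeastAtMostSuc_conv)
qed

lemma state_Infected_level_le:
  "state T r \<sigma> t v = Infected \<Longrightarrow> level T r v \<le> t"
proof (induction t arbitrary: v)
  case 0
  then show ?case
    using level_eq_0_iff root_in_verts by (auto split: if_splits)
next
  case (Suc t)
  have "vaccinate (\<sigma> (Suc t)) (state T r \<sigma> t) w = Infected \<Longrightarrow> state T r \<sigma> t w = Infected" for w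
    by (auto simp: vaccinate_def split: option.splits if_splits)
  then have "state T r \<sigma> t v = Infected \<or> (\<exists>w. w \<rightarrow>\<^bsub>T\<^esub> v \<and> state T r \<sigma> t w = Infected)"
    using Suc.prems by (auto simp: spread_def split: if_splits)
  then show ?case
    using Suc.IH level_adj_le by (meson Suc_le_mono le_SucI order_trans)
qed

lemma unvaccinated_path_infected:
  assumes "valid_strategy T r \<sigma>" "path_between T r p v"
    and "\<And>i t. i < length p \<Longrightarrow> t \<in> {1..i} \<Longrightarrow> \<sigma> t \<noteq> Some (p ! i)"
  shows "i < length p \<Longrightarrow> state T r \<sigma> i (p ! i) = Infected"
proof (induction i)
  case 0
  then show ?case
    using path_from_root_props(3)[OF assms(2)] by simp
next
  case (Suc i)
  let ?s = "vaccinate (\<sigma> (Suc i)) (state T r \<sigma> i)"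
  have inf: "state T r \<sigma> i (p ! i) = Infected"
    using Suc by simp
  then have "\<sigma> (Suc i) \<noteq> Some (p ! i)"
    using assms(1) by (auto simp: valid_strategy_def)
  then have 1: "?s (p ! i) = Infected"
    using inf by (auto simp: vaccinate_def split: option.splits)
  have "state T r \<sigma> i (p ! Suc i) \<noteq> Vaccinated"
    using state_Vaccinated_imp[of \<sigma> i "p ! Suc i"] assms(3)[OF Suc.prems] by auto
  moreover have "\<sigma> (Suc i) \<noteq> Some (p ! Suc i)"
    using assms(3)[OF Suc.prems] by auto
  ultimately have 2: "?s (p ! Suc i) \<noteq> Vaccinated"
    by (auto simp: vaccinate_def split: option.splits)
  have "p ! i \<rightarrow>\<^bsub>T\<^esub> p ! Suc i"
    using vwalk_nth_adj[OF path_from_root_props(8)[OF assms(2)] Suc.prems] .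
  then show ?case
    using 1 2 by (cases "?s (p ! Suc i)") (auto simp: spread_def)
qed

lemma saved_imp_vaccinated_in_time:
  assumes "valid_strategy T r \<sigma>" "v \<in> saved T r \<sigma>"
  obtains t x where "1 \<le> t" "t \<le> level T r x" "\<sigma> t = Some x" "x \<in> verts T"
    "v \<in> subtree_verts T r x"
proof -
  obtain p where p: "path_between T r p v"
    using path_from_root_exists assms(2) by (auto simp: saved_def)
  note props = path_from_root_props[OF p]
  have "\<exists>i t. i < length p \<and> t \<in> {1..i} \<and> \<sigma> t = Some (p ! i)"
  proof (rule ccontr)
    assume "\<not> ?thesis"
    then have "state T r \<sigma> (level T r v) (p ! level T r v) = Infected"
      using unvaccinated_path_infected[OF assms(1) p _ props(6)] by blast
    then show False
      using assms(2) props(7) by (auto simp: saved_def)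
  qed
  then obtain i t where it: "i < length p" "t \<in> {1..i}" "\<sigma> t = Some (p ! i)"
    by blast
  moreover have "p ! i \<in> set p" "p ! i \<in> verts T"
    using it(1) props(2) nth_mem by blast+
  ultimately show ?thesis
    using that[of t "p ! i"] level_path_nth[OF p it(1)] subtree_verts_iff[OF p]
    by auto
qed

lemma saved_subset_one_per_level:
  assumes "valid_strategy T r \<sigma>"
    and u: "\<And>i. i \<in> {1..max_level T r} \<Longrightarrow> u i \<in> verts T \<and> level T r (u i) = i"
  obtains w where "\<And>i. i \<in> {1..max_level T r} \<Longrightarrow> w i \<in> verts T \<and> level T r (w i) = i"
    "saved T r \<sigma> \<subseteq> (\<Union>i \<in> {1..max_level T r}. subtree_verts T r (w i))"
proof -
  have "\<exists>y \<in> verts T. level T r y = i \<and> (\<forall>x \<in> verts T. \<sigma> i = Some x \<and> i \<le> level T r x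
      \<longrightarrow> subtree_verts T r x \<subseteq> subtree_verts T r y)" if i: "i \<in> {1..max_level T r}" for i
  proof (cases "\<exists>x \<in> verts T. \<sigma> i = Some x \<and> i \<le> level T r x")
    case True
    then obtain x where "x \<in> verts T" "\<sigma> i = Some x" "i \<le> level T r x"
      by blast
    then show ?thesis
      using ancestor_at_level[of x i] subtree_verts_mono by (metis option.inject)
  next
    case False
    then show ?thesis
      using u[OF i] by blast
  qed
  then obtain w where w: "\<And>i. i \<in> {1..max_level T r} \<Longrightarrow> w i \<in> verts T \<and> level T r (w i) = i \<and>
      (\<forall>x \<in> verts T. \<sigma> i = Some x \<and> i \<le> level T r x
        \<longrightarrow> subtree_verts T r x \<subseteq> subtree_verts T r (w i))"
    by metis
  have "saved T r \<sigma> \<subseteq> (\<Union>i \<in> {1..max_level T r}. subtree_verts T r (w i))"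
  proof
    fix v assume "v \<in> saved T r \<sigma>"
    then obtain t x where tx: "1 \<le> t" "t \<le> level T r x" "\<sigma> t = Some x" "x \<in> verts T"
      "v \<in> subtree_verts T r x"
      using saved_imp_vaccinated_in_time[OF assms(1)] by blast
    then have "t \<in> {1..max_level T r}"
      using level_le_max_level[of x] by simp
    then show "v \<in> (\<Union>i \<in> {1..max_level T r}. subtree_verts T r (w i))"
      using w[of t] tx by blast
  qed
  then show ?thesis
    using that w by blast
qed

lemma state_Vaccinated_persists:
  "state T r \<sigma> s v = Vaccinated \<Longrightarrow> s \<le> t \<Longrightarrow> state T r \<sigma> t v = Vaccinated"
proof (induction t)
  case (Suc t)
  then show ?case
    by (cases "s = Suc t") (auto simp: spread_def vaccinate_def split: option.splits)
qed simp

lemma subtree_of_timely_vaccination_saved: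
  assumes "\<sigma> t = Some x" "1 \<le> t" "t \<le> level T r x"
  shows "subtree_verts T r x \<subseteq> saved T r \<sigma>"
proof -
  have "state T r \<sigma> t x = Vaccinated"
    using assms(1,2) by (cases t) (auto simp: spread_def vaccinate_def)
  then have vac: "state T r \<sigma> s x = Vaccinated" if "t \<le> s" for s
    using state_Vaccinated_persists that by blast
  have "state T r \<sigma> s v \<noteq> Infected" if "v \<in> subtree_verts T r x" for s v
    using that
  proof (induction s arbitrary: v)
    case 0
    then show ?case
      using level_subtree_verts_ge[OF 0] state_Infected_level_le[of \<sigma> 0 v] assms(2,3) by auto
  next
    case (Suc s)
    show ?case
    proof (cases "t \<le> Suc s")
      case False
      then show ?thesis
        using level_subtree_verts_ge[OF Suc.prems] state_Infected_level_le[of \<sigma> "Suc s" v] assms(3)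
        by auto
    next
      case True
      let ?s = "vaccinate (\<sigma> (Suc s)) (state T r \<sigma> s)"
      have vi: "?s w = Infected \<Longrightarrow> state T r \<sigma> s w = Infected" for w
        by (auto simp: vaccinate_def split: option.splits if_splits)
      show ?thesis
      proof
        assume inf: "state T r \<sigma> (Suc s) v = Infected"
        then have "v \<noteq> x"
          using vac[OF True] by auto
        have "?s v \<noteq> Infected"
          using vi Suc by blast
        then obtain w where "w \<rightarrow>\<^bsub>T\<^esub> v" "?s w = Infected"
          using inf by (auto simp: spread_def split: if_splits)
        then show False
          using subtree_verts_entry[of w v x] Suc \<open>v \<noteq> x\<close> vi by blast
      qed
    qed
  qed
  then show ?thesis
    using subtree_verts_subset_verts by (auto simp: saved_def)
qed


section \<open>The Unburning Algorithm\<close>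

context
  fixes u :: "nat \<Rightarrow> 'a"
  assumes u: "\<And>i. i \<in> {1..max_level T r} \<Longrightarrow> u i \<in> verts T \<and> level T r (u i) = i"
begin

lemma valid_sequence_strategy: "valid_strategy T r (sequence_strategy (max_level T r) u)"
  unfolding valid_strategy_def
proof (intro allI impI)
  let ?\<sigma> = "sequence_strategy (max_level T r) u"
  fix t v assume "?\<sigma> (Suc t) = Some v"
  then have v: "v = u (Suc t)" "v \<in> verts T" "level T r v = Suc t"
    using u[of "Suc t"] by (auto simp: sequence_strategy_def split: if_splits)
  have "state T r ?\<sigma> t v \<noteq> Infected"
    using state_Infected_level_le v(3) by fastforce
  moreover have "state T r ?\<sigma> t v \<noteq> Vaccinated"
  proof
    assume "state T r ?\<sigma> t v = Vaccinated"
    then obtain s where "s \<in> {1..t}" "?\<sigma> s = Some v"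
      using state_Vaccinated_imp by blast
    then show False
      using u[of s] v(3) by (auto simp: sequence_strategy_def split: if_splits)
  qed
  ultimately show "v \<in> verts T \<and> state T r ?\<sigma> t v = Susceptible"
    using v(2) by (cases "state T r ?\<sigma> t v") auto
qed

lemma saved_sequence_strategy:
  "saved T r (sequence_strategy (max_level T r) u)
     = (\<Union>i \<in> {1..max_level T r}. subtree_verts T r (u i))" (is "saved T r ?\<sigma> = ?A")
proof
  show "saved T r ?\<sigma> \<subseteq> ?A"
  proof
    fix v assume "v \<in> saved T r ?\<sigma>"
    then obtain t x where "?\<sigma> t = Some x" "v \<in> subtree_verts T r x"
      using saved_imp_vaccinated_in_time[OF valid_sequence_strategy] by blast
    then show "v \<in> ?A"
      by (auto simp: sequence_strategy_def split: if_splits)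
  qed
  show "?A \<subseteq> saved T r ?\<sigma>"
  proof (rule UN_least)
    fix i assume "i \<in> {1..max_level T r}"
    then show "subtree_verts T r (u i) \<subseteq> saved T r ?\<sigma>"
      using u by (intro subtree_of_timely_vaccination_saved[of _ i]) (auto simp: sequence_strategy_def)
  qed
qed

lemma covered_eq:
  assumes "level T r v = i"
  shows "covered T r u v
    = subtree_verts T r v \<inter> (\<Union>j \<in> {Suc i..max_level T r}. subtree_verts T r (u j))"
proof (intro equalityI subsetI)
  fix x assume "x \<in> covered T r u v"
  then obtain j where j: "i < j" "j \<le> max_level T r" "u j \<in> subtree_verts T r v"
    "x \<in> subtree_verts T r (u j)"
    using assms by (auto simp: covered_def)
  then have "x \<in> subtree_verts T r v"
    using subtree_verts_mono by blast
  then show "x \<in> subtree_verts T r v \<inter> (\<Union>j \<in> {Suc i..max_level T r}. subtree_verts T r (u j))"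
    using j by auto
next
  fix x assume "x \<in> subtree_verts T r v \<inter> (\<Union>j \<in> {Suc i..max_level T r}. subtree_verts T r (u j))"
  then obtain j where j: "Suc i \<le> j" "j \<le> max_level T r" "x \<in> subtree_verts T r (u j)"
    and x: "x \<in> subtree_verts T r v"
    by auto
  then have "u j \<in> subtree_verts T r v"
    using subtree_verts_comparable[OF x j(3)] u[of j] assms by simp
  then show "x \<in> covered T r u v"
    using j assms Suc_le_lessD unfolding covered_def by blast
qed

lemma unburning_weight_eq:
  assumes "level T r v = i"
  shows "unburning_weight T r u v
    = int (card (subtree_verts T r v - (\<Union>j \<in> {Suc i..max_level T r}. subtree_verts T r (u j))))"
  unfolding unburning_weight_def covered_eq[OF assms]
  by (simp add: card_Diff_subset_Int card_mono of_nat_diff)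

lemma sum_unburning_weight:
  "int (card (\<Union>i \<in> {1..max_level T r}. subtree_verts T r (u i)))
     = (\<Sum>i = 1..max_level T r. unburning_weight T r u (u i))"
proof -
  let ?n = "max_level T r"
  let ?A = "\<lambda>k. \<Union>i \<in> {k..?n}. subtree_verts T r (u i)"
  have "1 \<le> k \<Longrightarrow> int (card (?A k)) = (\<Sum>i = k..?n. unburning_weight T r u (u i))"
    if "k \<le> Suc ?n" for k
    using that
  proof (induction k rule: inc_induct)
    case base
    then show ?case by simp
  next
    case (step k)
    then have k: "1 \<le> k" "k \<le> ?n"
      by auto
    have "?A k = ?A (Suc k) \<union> (subtree_verts T r (u k) - ?A (Suc k))"
      using k(2) by (auto simp: atLeastAtMost_insertL[symmetric])
    then have "card (?A k) = card (?A (Suc k)) + card (subtree_verts T r (u k) - ?A (Suc k))"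
      by (metis (no_types, lifting) Diff_disjoint card_Un_disjoint finite_Diff finite_UN
          finite_atLeastAtMost finite_subtree_verts)
    then show ?case
      using step.IH k u[of k] unburning_weight_eq[of "u k" k]
      by (simp add: sum.atLeast_Suc_atMost)
  qed
  from this[of 1] show ?thesis
    by simp
qed

end

lemma card_saved_le_twice:
  assumes "unburning_sequence T r u" "valid_strategy T r \<sigma>"
  shows "card (saved T r \<sigma>) \<le> 2 * card (\<Union>i \<in> {1..max_level T r}. subtree_verts T r (u i))"
proof -
  let ?n = "max_level T r"
  let ?A = "\<Union>i \<in> {1..?n}. subtree_verts T r (u i)"
  have u: "u i \<in> verts T \<and> level T r (u i) = i" if "i \<in> {1..?n}" for i
    using assms(1) that by (auto simp: unburning_sequence_def)
  obtain w where w: "\<And>i. i \<in> {1..?n} \<Longrightarrow> w i \<in> verts T \<and> level T r (w i) = i"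
    and sub: "saved T r \<sigma> \<subseteq> (\<Union>i \<in> {1..?n}. subtree_verts T r (w i))"
    using saved_subset_one_per_level[OF assms(2) u] by blast
  have weight: "int (card (subtree_verts T r (w i) - ?A)) \<le> unburning_weight T r u (u i)"
    if i: "i \<in> {1..?n}" for i
  proof -
    have "card (subtree_verts T r (w i) - ?A)
      \<le> card (subtree_verts T r (w i) - (\<Union>j \<in> {Suc i..?n}. subtree_verts T r (u j)))"
      by (rule card_mono) auto
    then have "int (card (subtree_verts T r (w i) - ?A)) \<le> unburning_weight T r u (w i)"
      using unburning_weight_eq[OF u, of "w i" i] w[OF i] by simp
    also have "\<dots> \<le> unburning_weight T r u (u i)"
      using assms(1) i w[OF i] by (auto simp: unburning_sequence_def)
    finally show ?thesis .
  qed
  have "card (saved T r \<sigma>) \<le> card (?A \<union> (\<Union>i \<in> {1..?n}. subtree_verts T r (w i) - ?A))"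
    using sub by (intro card_mono) auto
  also have "\<dots> \<le> card ?A + card (\<Union>i \<in> {1..?n}. subtree_verts T r (w i) - ?A)"
    by (rule card_Un_le)
  also have "\<dots> \<le> card ?A + (\<Sum>i = 1..?n. card (subtree_verts T r (w i) - ?A))"
    using card_UN_le[of "{1..?n}" "\<lambda>i. subtree_verts T r (w i) - ?A"] by simp
  finally have "int (card (saved T r \<sigma>))
      \<le> int (card ?A) + (\<Sum>i = 1..?n. int (card (subtree_verts T r (w i) - ?A)))"
    by (metis of_nat_add of_nat_mono of_nat_sum)
  also have "\<dots> \<le> int (card ?A) + (\<Sum>i = 1..?n. unburning_weight T r u (u i))"
    using sum_mono[of "{1..?n}", OF weight] by simp
  also have "\<dots> = 2 * int (card ?A)"
    using sum_unburning_weight[OF u] by simp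
  finally show ?thesis
    by linarith
qed

lemma max_saved_attained: "\<exists>\<sigma>. valid_strategy T r \<sigma> \<and> max_saved T r = card (saved T r \<sigma>)"
proof -
  let ?C = "{card (saved T r \<sigma>) | \<sigma>. valid_strategy T r \<sigma>}"
  have "?C \<subseteq> {..card (verts T)}"
    by (auto simp: saved_def intro!: card_mono)
  then have "finite ?C"
    using finite_subset by blast
  moreover have "valid_strategy T r (\<lambda>_. None)"
    by (simp add: valid_strategy_def)
  then have "?C \<noteq> {}"
    by blast
  ultimately show ?thesis
    using Max_in[of ?C] by (auto simp: max_saved_def)
qed

end

theorem theorem1p1:
  fixes T :: "('a, 'b) pre_digraph" and r :: 'a and n :: nat and u :: "nat \<Rightarrow> 'a"
  assumes "rooted_tree T r"
    and "\<exists>v \<in> verts T. v \<noteq> r"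
    and "n = max_level T r"
    and "unburning_sequence T r u"
  shows "valid_strategy T r (sequence_strategy n u)
    \<and> card (saved T r (sequence_strategy n u)) = card (\<Union>i \<in> {1..n}. subtree_verts T r (u i))
    \<and> int (card (\<Union>i \<in> {1..n}. subtree_verts T r (u i)))
        = (\<Sum>i = 1..n. unburning_weight T r u (u i))
    \<and> real (card (saved T r (sequence_strategy n u))) \<ge> real (max_saved T r) / 2"
proof -
  interpret rooted_tree T r
    by fact
  have u: "u i \<in> verts T \<and> level T r (u i) = i" if "i \<in> {1..max_level T r}" for i
    using assms(4) that by (auto simp: unburning_sequence_def)
  have "max_saved T r \<le> 2 * card (saved T r (sequence_strategy n u))"
    using max_saved_attained card_saved_le_twice[OF assms(4)] saved_sequence_strategy[OF u] assms(3)
    by metis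
  then show ?thesis
    using valid_sequence_strategy[OF u] saved_sequence_strategy[OF u] sum_unburning_weight[OF u]
      assms(3) by simp
qed

end
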